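(* Let $c$ be a real constant, $M>0$, $w>0$, and let $g=-\frac{dT^2}{(V+cT)^2}+(V+cT)^2\,(d\rho^2+\rho^2d\phi^2+dz^2)$ be the equal-mass two-centre Kastor-Traschen metric, with $$V=\frac{M}{(\rho^2+(z-w)^2)^{1/2}}+\frac{M}{(\rho^2+(z+w)^2)^{1/2}}.$$ If the retraction projection of a null geodesic of $g$ has the property that its initial position and initial velocity lie in the plane passing orthogonally through the midpoint of the line segment joining the two centres (the plane $z=0$, the centres being $\rho=0$, $z=\pm w$), then the entire projected null geodesic lies in that plane.
   Context: $(\rho,\phi,z)$ are cylindrical polar coordinates on $\mathbb{R}^3$, so $d\rho^2+\rho^2d\phi^2+dz^2$ is the flat Euclidean metric. The metric $g$ is considered on the set of $(T,\mathbf{x})$, $T\in\mathbb{R}$, $\mathbf{x}\in\mathbb{R}^3$ different from the two centres, where $V(\mathbf{x})+cT\neq0$. The retraction projection of a curve $(T(s),\mathbf{x}(s))$ is its spatial part $\mathbf{x}(s)\in\mathbb{R}^3$, i.e. its image in the space of orbits of $\partial/\partial T$. "Initial velocity lies in the plane" means that the velocity vector is tangent to the plane. *)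

theory Defs
  imports "HOL-Analysis.Analysis"
begin

text \<open>A (pseudo-Riemannian) metric on an open set of \<open>real ^ 'n\<close> is given by its matrix of
  coefficients \<open>g p $ i $ j\<close> in the standard coordinates.\<close>

definition partial_deriv :: "'n \<Rightarrow> (real ^ 'n \<Rightarrow> real) \<Rightarrow> real ^ 'n \<Rightarrow> real" where
  "partial_deriv k f p = frechet_derivative f (at p) (axis k 1)"

text \<open>\<open>christoffel g p k i j\<close> is the symbol of the second kind with upper index \<open>k\<close>.\<close>

definition christoffel ::
  "(real ^ 'n \<Rightarrow> real ^ 'n ^ 'n) \<Rightarrow> real ^ 'n \<Rightarrow> 'n \<Rightarrow> 'n \<Rightarrow> 'n \<Rightarrow> real" where
  "christoffel g p k i j =
     (1 / 2) * (\<Sum>l\<in>UNIV. matrix_inv (g p) $ k $ l *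
        (partial_deriv i (\<lambda>q. g q $ j $ l) p + partial_deriv j (\<lambda>q. g q $ i $ l) p
          - partial_deriv l (\<lambda>q. g q $ i $ j) p))"

text \<open>One-sided at those endpoints of the interval \<open>I\<close> that belong to \<open>I\<close>.\<close>

definition velocity :: "real set \<Rightarrow> (real \<Rightarrow> real ^ 'n) \<Rightarrow> real \<Rightarrow> real ^ 'n" where
  "velocity I \<gamma> s = vector_derivative \<gamma> (at s within I)"

text \<open>Affinely parametrised geodesics, on any nondegenerate interval (open, closed, half-open,
  bounded or not).\<close>

definition geodesic_on ::
  "(real ^ 'n \<Rightarrow> real ^ 'n ^ 'n) \<Rightarrow> (real ^ 'n) set \<Rightarrow> real set \<Rightarrow> (real \<Rightarrow> real ^ 'n) \<Rightarrow> bool" where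
  "geodesic_on g U I \<gamma> \<longleftrightarrow>
     is_interval I \<and> interior I \<noteq> {} \<and> \<gamma> ` I \<subseteq> U \<and>
     \<gamma> differentiable_on I \<and> velocity I \<gamma> differentiable_on I \<and>
     (\<forall>s\<in>I. \<forall>k. velocity I (velocity I \<gamma>) s $ k +
        (\<Sum>i\<in>UNIV. \<Sum>j\<in>UNIV. christoffel g (\<gamma> s) k i j *
           velocity I \<gamma> s $ i * velocity I \<gamma> s $ j) = 0)"

definition null_vector :: "real ^ 'n ^ 'n \<Rightarrow> real ^ 'n \<Rightarrow> bool" where
  "null_vector G v \<longleftrightarrow> v \<noteq> 0 \<and> v \<bullet> (G *v v) = 0"

definition null_geodesic_on ::
  "(real ^ 'n \<Rightarrow> real ^ 'n ^ 'n) \<Rightarrow> (real ^ 'n) set \<Rightarrow> real set \<Rightarrow> (real \<Rightarrow> real ^ 'n) \<Rightarrow> bool" where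
  "null_geodesic_on g U I \<gamma> \<longleftrightarrow>
     geodesic_on g U I \<gamma> \<and> (\<forall>s\<in>I. null_vector (g (\<gamma> s)) (velocity I \<gamma> s))"

text \<open>Spacetime points are \<open>(T, x, y, z)\<close>, with indices \<open>1, 2, 3, 4\<close>; here \<open>(x, y, z)\<close> are the
  Cartesian coordinates belonging to the cylindrical coordinates \<open>(\<rho>, \<phi>, z)\<close>, so that the flat
  spatial metric is the identity matrix, also on the axis \<open>\<rho> = 0\<close>.\<close>

definition time :: "real ^ 4 \<Rightarrow> real" where
  "time p = p $ 1"

definition retraction_proj :: "real ^ 4 \<Rightarrow> real ^ 3" where
  "retraction_proj p = vector [p $ 2, p $ 3, p $ 4]"

definition cyl_radius :: "real ^ 3 \<Rightarrow> real" where
  "cyl_radius x = sqrt ((x $ 1)\<^sup>2 + (x $ 2)\<^sup>2)"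

definition KT_potential :: "real \<Rightarrow> real \<Rightarrow> real ^ 3 \<Rightarrow> real" where
  "KT_potential M w x =
     M / sqrt ((cyl_radius x)\<^sup>2 + (x $ 3 - w)\<^sup>2) + M / sqrt ((cyl_radius x)\<^sup>2 + (x $ 3 + w)\<^sup>2)"

definition KT_factor :: "real \<Rightarrow> real \<Rightarrow> real \<Rightarrow> real ^ 4 \<Rightarrow> real" where
  "KT_factor c M w p = KT_potential M w (retraction_proj p) + c * time p"

definition KT_domain :: "real \<Rightarrow> real \<Rightarrow> real \<Rightarrow> (real ^ 4) set" where
  "KT_domain c M w =
     {p. retraction_proj p \<noteq> vector [0, 0, w] \<and> retraction_proj p \<noteq> vector [0, 0, - w] \<and>
         KT_factor c M w p \<noteq> 0}"

definition KT_metric :: "real \<Rightarrow> real \<Rightarrow> real \<Rightarrow> real ^ 4 \<Rightarrow> real ^ 4 ^ 4" where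
  "KT_metric c M w p =
     (\<chi> i j. if i \<noteq> j then 0
            else if i = 1 then - 1 / (KT_factor c M w p)\<^sup>2
            else (KT_factor c M w p)\<^sup>2)"

text \<open>The plane \<open>z = 0\<close>; being a linear subspace, it is also its own space of tangent vectors.\<close>

definition mid_plane :: "(real ^ 3) set" where
  "mid_plane = {x. x $ 3 = 0}"

end

theory Submission
  imports Defs
begin

text \<open>The component of the geodesic equation orthogonal to the plane is linear homogeneous in \<open>z\<close> and
  \<open>z'\<close> along the given curve: by the reflection symmetry of the potential, \<open>\<partial>V/\<partial>z\<close> is \<open>z\<close> times a
  function that is continuous off the centres, so \<open>z'' = A z' + B z\<close> with \<open>A\<close>, \<open>B\<close> continuous on
  the parameter interval. Vanishing initial data then force \<open>z = 0\<close>, by a Gronwall argument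
  for \<open>z\<^sup>2 + z'\<^sup>2\<close>.\<close>

section \<open>Uniqueness of the zero solution of a linear second-order equation\<close>

text \<open>The bound makes \<open>E s * exp (- K * s)\<close> nonincreasing and
  \<open>E s * exp (K * s)\<close> nondecreasing. The first carries a zero of \<open>E\<close> from
  \<open>a\<close> to \<open>b\<close>, the second from \<open>b\<close> to \<open>a\<close>; both
  directions matter because the initial parameter may be either endpoint.\<close>

lemma gronwall_endpoints_zero:
  fixes E E' :: "real \<Rightarrow> real"
  assumes "a \<le> b"
    and deriv: "\<And>s. s \<in> {a..b} \<Longrightarrow> (E has_real_derivative E' s) (at s within {a..b})"
    and bound: "\<And>s. s \<in> {a..b} \<Longrightarrow> \<bar>E' s\<bar> \<le> K * E s"
    and nonneg: "\<And>s. 0 \<le> E s"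
  shows "E a = 0 \<longleftrightarrow> E b = 0"
proof -
  have scaled: "((\<lambda>s. E s * exp (L * s)) has_real_derivative (E' s + L * E s) * exp (L * s))
      (at s within {a..b})" if "s \<in> {a..b}" for s L
    by (auto intro!: derivative_eq_intros deriv[OF that] simp: algebra_simps)
  have interior: "((\<lambda>s. E s * exp (L * s)) has_real_derivative (E' s + L * E s) * exp (L * s)) (at s)"
    if "a < s" "s < b" for s L
  proof -
    have "s \<in> {a..b}" using that by simp
    from scaled[OF this, of L] show ?thesis by (simp only: at_within_Icc_at[OF that])
  qed
  have cont: "continuous_on {a..b} (\<lambda>s. E s * exp (L * s))" for L
    by (rule DERIV_continuous_on) (rule scaled)
  have "E b * exp (- K * b) \<le> E a * exp (- K * a)"
  proof (rule DERIV_nonpos_imp_decreasing_open[OF \<open>a \<le> b\<close> _ cont])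
    fix s assume s: "a < s" "s < b"
    have "E' s + - K * E s \<le> 0" using bound[of s] s by auto
    then show "\<exists>y. ((\<lambda>s. E s * exp (- K * s)) has_real_derivative y) (at s) \<and> y \<le> 0"
      using interior[OF s] by (meson mult_nonpos_nonneg exp_ge_zero)
  qed
  moreover have "E a * exp (K * a) \<le> E b * exp (K * b)"
  proof (rule DERIV_nonneg_imp_increasing_open[OF \<open>a \<le> b\<close> _ cont])
    fix s assume s: "a < s" "s < b"
    have "0 \<le> E' s + K * E s" using bound[of s] s by auto
    then show "\<exists>y. ((\<lambda>s. E s * exp (K * s)) has_real_derivative y) (at s) \<and> 0 \<le> y"
      using interior[OF s] by (meson mult_nonneg_nonneg exp_ge_zero)
  qed
  ultimately have "E a = 0 \<Longrightarrow> E b \<le> 0" "E b = 0 \<Longrightarrow> E a \<le> 0"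
    by (simp_all add: mult_le_0_iff)
  then show ?thesis
    using nonneg[of a] nonneg[of b] by linarith
qed

lemma linear_ode_zero:
  fixes z z' A B :: "real \<Rightarrow> real"
  assumes "is_interval I" and "s\<^sub>0 \<in> I" and "t \<in> I"
    and dz: "\<And>s. s \<in> I \<Longrightarrow> (z has_real_derivative z' s) (at s within I)"
    and dz': "\<And>s. s \<in> I \<Longrightarrow> (z' has_real_derivative A s * z' s + B s * z s) (at s within I)"
    and "continuous_on I A" and "continuous_on I B"
    and "z s\<^sub>0 = 0" and "z' s\<^sub>0 = 0"
  shows "z t = 0"
proof -
  \<comment> \<open>The Gronwall estimate runs on the compact segment between
    \<open>s\<^sub>0\<close> and \<open>t\<close>, in whichever order they lie: \<open>A\<close> and
    \<open>B\<close> are bounded there, though possibly not on all of \<open>I\<close>.\<close>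
  define a b where "a = min s\<^sub>0 t" and "b = max s\<^sub>0 t"
  have "a \<le> b" by (simp add: a_def b_def)
  have "a \<in> I" "b \<in> I"
    using assms(2,3) by (simp_all add: a_def b_def min_def max_def)
  then have sub: "{a..b} \<subseteq> I"
    using mem_is_interval_1_I[OF assms(1)] by (meson atLeastAtMost_iff subsetI)
  have "bounded (A ` {a..b})" "bounded (B ` {a..b})"
    using assms(6,7) sub
    by (auto intro!: compact_imp_bounded compact_continuous_image intro: continuous_on_subset)
  then obtain \<alpha> \<beta> where \<alpha>: "\<And>s. s \<in> {a..b} \<Longrightarrow> \<bar>A s\<bar> \<le> \<alpha>"
    and \<beta>: "\<And>s. s \<in> {a..b} \<Longrightarrow> \<bar>B s\<bar> \<le> \<beta>"
    unfolding bounded_iff by fastforce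
  define E where "E s = (z s)\<^sup>2 + (z' s)\<^sup>2" for s
  \<comment> \<open>This is 2 z z' + 2 z' z'' with the equation inserted for z'', sorted into a
    mixed term and a square.\<close>
  define E' where "E' s = 2 * (1 + B s) * (z s * z' s) + 2 * A s * (z' s)\<^sup>2" for s
  have "E a = 0 \<longleftrightarrow> E b = 0"
  proof (rule gronwall_endpoints_zero[OF \<open>a \<le> b\<close>])
    fix s assume s: "s \<in> {a..b}"
    then have "s \<in> I" using sub by auto
    show "(E has_real_derivative E' s) (at s within {a..b})"
      unfolding E_def E'_def
      by (auto intro!: derivative_eq_intros DERIV_subset[OF dz[OF \<open>s \<in> I\<close>] sub]
          DERIV_subset[OF dz'[OF \<open>s \<in> I\<close>] sub] simp: algebra_simps power2_eq_square)
    \<comment> \<open>The inequality 2xy \<le> x^2 + y^2 bounds the mixed term of \<open>E'\<close>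
      by a multiple of \<open>E\<close>; the square term is at most a multiple of \<open>E\<close>
      anyway.\<close>
    have zz: "2 * \<bar>z s * z' s\<bar> \<le> E s"
      using sum_squares_bound[of "\<bar>z s\<bar>" "\<bar>z' s\<bar>"] by (simp add: E_def abs_mult)
    have "\<bar>E' s\<bar> \<le> \<bar>1 + B s\<bar> * (2 * \<bar>z s * z' s\<bar>) + \<bar>A s\<bar> * (2 * (z' s)\<^sup>2)"
      unfolding E'_def by (rule order_trans[OF abs_triangle_ineq])
        (simp add: abs_mult del: distrib_left_numeral)
    also have "\<dots> \<le> (1 + \<beta>) * E s + \<alpha> * (2 * E s)"
      using \<alpha>[OF s] \<beta>[OF s] zz
      by (intro add_mono mult_mono) (auto simp: E_def)
    finally show "\<bar>E' s\<bar> \<le> (1 + \<beta> + 2 * \<alpha>) * E s" by (simp add: algebra_simps)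
  qed (simp add: E_def)
  moreover have "E s\<^sub>0 = 0" using assms by (simp add: E_def)
  ultimately have "E t = 0"
    by (auto simp: a_def b_def min_def max_def split: if_splits)
  then show ?thesis by (simp add: E_def sum_power2_eq_zero_iff)
qed

section \<open>The conformal factor and its differential\<close>

text \<open>Euclidean distance of the spatial part to the centre (0, 0, a), so that
  \<open>a = w\<close> and \<open>a = - w\<close> treat both centres at once. Cartesian coordinates
  avoid a special case on the axis.\<close>

definition centre_dist :: "real \<Rightarrow> real ^ 4 \<Rightarrow> real" where
  "centre_dist a p = sqrt ((p $ 2)\<^sup>2 + (p $ 3)\<^sup>2 + (p $ 4 - a)\<^sup>2)"

text \<open>At points of \<open>KT_domain\<close> this is the Frechet derivative of
  \<open>KT_factor\<close> at \<open>p\<close> in direction \<open>h\<close>. Keeping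
  \<open>h\<close> general lets one formula serve for the derivative along the velocity and for the
  z-derivative.\<close>

definition KT_differential :: "real \<Rightarrow> real \<Rightarrow> real \<Rightarrow> real ^ 4 \<Rightarrow> real ^ 4 \<Rightarrow> real" where
  "KT_differential c M w p h =
     - M * (p $ 2 * h $ 2 + p $ 3 * h $ 3 + (p $ 4 - w) * h $ 4) / centre_dist w p ^ 3
     + - M * (p $ 2 * h $ 2 + p $ 3 * h $ 3 + (p $ 4 + w) * h $ 4) / centre_dist (- w) p ^ 3
     + c * h $ 1"

text \<open>The quotient of \<open>\<partial>V/\<partial>z\<close> by \<open>z\<close>. The factor \<open>z\<close> of the difference \<open>1 / r ^ 3 - 1 / r' ^ 3\<close> is
  extracted by means of \<open>(r' - r) * (r' + r) = 4 * w * z\<close>, so that no division by \<open>z\<close> remains.\<close>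

definition KT_restoring :: "real \<Rightarrow> real \<Rightarrow> real ^ 4 \<Rightarrow> real" where
  "KT_restoring M w p =
     (let r = centre_dist w p; r' = centre_dist (- w) p in
       4 * M * w\<^sup>2 * (r\<^sup>2 + r * r' + r'\<^sup>2) / ((r + r') * r ^ 3 * r' ^ 3)
         - M * (1 / r ^ 3 + 1 / r' ^ 3))"

lemma centre_dist_pos:
  assumes "retraction_proj p \<noteq> vector [0, 0, a]"
  shows "0 < centre_dist a p"
proof -
  have "retraction_proj p = vector [0, 0, a]"
    if "p $ 2 = 0" "p $ 3 = 0" "p $ 4 = a"
    using that by (simp add: retraction_proj_def)
  then have "p $ 2 \<noteq> 0 \<or> p $ 3 \<noteq> 0 \<or> p $ 4 - a \<noteq> 0" using assms by auto
  then show ?thesis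
    unfolding centre_dist_def real_sqrt_gt_0_iff
    by (metis add_nonneg_pos add_pos_nonneg add_nonneg_nonneg zero_le_power2 zero_less_power2)
qed

lemma KT_domainD:
  assumes "p \<in> KT_domain c M w"
  shows "0 < centre_dist w p" "0 < centre_dist (- w) p" "KT_factor c M w p \<noteq> 0"
  using assms by (auto simp: KT_domain_def intro: centre_dist_pos)

lemma KT_factor_alt:
  "KT_factor c M w p = M / centre_dist w p + M / centre_dist (- w) p + c * p $ 1"
  by (simp add: KT_factor_def KT_potential_def cyl_radius_def retraction_proj_def time_def
      centre_dist_def)

lemma centre_dist_has_derivative:
  assumes "0 < centre_dist a p"
  shows "(centre_dist a has_derivative
    (\<lambda>h. (p $ 2 * h $ 2 + p $ 3 * h $ 3 + (p $ 4 - a) * h $ 4) / centre_dist a p)) (at p)"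
proof -
  have "0 < (p $ 2)\<^sup>2 + (p $ 3)\<^sup>2 + (p $ 4 - a)\<^sup>2"
    using assms by (simp add: centre_dist_def)
  then show ?thesis
    unfolding centre_dist_def[abs_def]
    by (auto intro!: derivative_eq_intros bounded_linear_imp_has_derivative[OF bounded_linear_vec_nth]
        simp: divide_simps)
qed

lemma KT_factor_has_derivative:
  assumes "p \<in> KT_domain c M w"
  shows "(KT_factor c M w has_derivative KT_differential c M w p) (at p)"
proof -
  note r = KT_domainD[OF assms]
  have recip: "((\<lambda>q. M / centre_dist a q) has_derivative
      (\<lambda>h. - M * (p $ 2 * h $ 2 + p $ 3 * h $ 3 + (p $ 4 - a) * h $ 4) / centre_dist a p ^ 3))
      (at p)" if "0 < centre_dist a p" for a
    by (rule derivative_eq_intros centre_dist_has_derivative that refl)+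
      (use that in \<open>auto simp: divide_simps power3_eq_cube\<close>)
  have "((\<lambda>q. c * q $ 1) has_derivative (\<lambda>h. c * h $ 1)) (at p)"
    by (intro bounded_linear_imp_has_derivative bounded_linear_mult_right[THEN bounded_linear_compose]
        bounded_linear_vec_nth)
  from has_derivative_add[OF has_derivative_add[OF recip[OF r(1)] recip[OF r(2)]] this]
  show ?thesis
    unfolding KT_factor_alt[abs_def] KT_differential_def[abs_def] by simp
qed

text \<open>The z-derivative splits into M w (1/r^3 - 1/r'^3) and a term with an explicit factor z.
  The difference also contains z, since the squared distances to the two centres differ by 4 w
  z.\<close>

lemma KT_differential_axis4:
  assumes "p \<in> KT_domain c M w"
  shows "KT_differential c M w p (axis 4 1) = p $ 4 * KT_restoring M w p"
proof -
  define r r' where "r = centre_dist w p" and "r' = centre_dist (- w) p"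
  have pos: "0 < r" "0 < r'" using KT_domainD[OF assms] by (auto simp: r_def r'_def)
  have "r\<^sup>2 = (p $ 2)\<^sup>2 + (p $ 3)\<^sup>2 + (p $ 4 - w)\<^sup>2"
    "r'\<^sup>2 = (p $ 2)\<^sup>2 + (p $ 3)\<^sup>2 + (p $ 4 + w)\<^sup>2"
    unfolding r_def r'_def centre_dist_def by simp_all
  then have "(r' - r) * (r + r') = 4 * p $ 4 * w"
    by (simp add: power2_eq_square algebra_simps)
  then have diff: "r' - r = 4 * p $ 4 * w / (r + r')"
    using pos by (simp add: field_simps)
  have "1 / r ^ 3 - 1 / r' ^ 3 = (r' ^ 3 - r ^ 3) / (r ^ 3 * r' ^ 3)"
    using pos by (simp add: field_simps)
  also have "r' ^ 3 - r ^ 3 = (r' - r) * (r\<^sup>2 + r * r' + r'\<^sup>2)"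
    by (simp add: power2_eq_square power3_eq_cube algebra_simps)
  finally have cubes: "1 / r ^ 3 - 1 / r' ^ 3
      = 4 * p $ 4 * w * (r\<^sup>2 + r * r' + r'\<^sup>2) / ((r + r') * r ^ 3 * r' ^ 3)"
    unfolding diff by simp
  have "KT_differential c M w p (axis 4 1)
      = M * w * (1 / r ^ 3 - 1 / r' ^ 3) - p $ 4 * M * (1 / r ^ 3 + 1 / r' ^ 3)"
    by (simp add: KT_differential_def axis_def diff_divide_distrib add_divide_distrib
        algebra_simps flip: r_def r'_def)
  also have "\<dots> = p $ 4 * KT_restoring M w p"
    unfolding cubes
    by (simp add: KT_restoring_def Let_def power2_eq_square algebra_simps flip: r_def r'_def)
  finally show ?thesis .
qed

section \<open>Inverse metric and Christoffel symbols\<close>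

text \<open>\<open>matrix_inv\<close> is a choice among two-sided inverses. A right inverse of a
  square matrix is also a left inverse, and inverses are unique, so the choice is forced.\<close>

lemma matrix_inv_eqI:
  fixes A B :: "real ^ 'n ^ 'n"
  assumes "A ** B = mat 1"
  shows "matrix_inv A = B"
  unfolding matrix_inv_def
  by (rule some_equality)
    (metis assms matrix_left_right_inverse matrix_mul_assoc matrix_mul_lid)+

lemma matrix_inv_KT_metric:
  assumes "KT_factor c M w p \<noteq> 0"
  shows "matrix_inv (KT_metric c M w p) =
    (\<chi> i j. if i \<noteq> j then 0 else if i = 1 then - (KT_factor c M w p)\<^sup>2
      else 1 / (KT_factor c M w p)\<^sup>2)"
  using assms
  by (intro matrix_inv_eqI)
    (simp add: vec_eq_iff forall_4 matrix_matrix_mult_def sum_4 mat_def KT_metric_def)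

lemma partial_deriv_KT_metric:
  assumes "(KT_factor c M w has_derivative F') (at p)" and "KT_factor c M w p \<noteq> 0"
  shows "partial_deriv k (\<lambda>q. KT_metric c M w q $ i $ j) p =
    (if i \<noteq> j then 0
     else if i = 1 then 2 * F' (axis k 1) / KT_factor c M w p ^ 3
     else 2 * KT_factor c M w p * F' (axis k 1))"
proof -
  have time: "((\<lambda>q. - 1 / (KT_factor c M w q)\<^sup>2) has_derivative
      (\<lambda>h. 2 * F' h / KT_factor c M w p ^ 3)) (at p)"
    using assms(2)
    by (auto intro!: derivative_eq_intros assms(1)
        simp: divide_simps power2_eq_square power3_eq_cube)
  have space: "((\<lambda>q. (KT_factor c M w q)\<^sup>2) has_derivative
      (\<lambda>h. 2 * KT_factor c M w p * F' h)) (at p)"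
    by (auto intro!: derivative_eq_intros assms(1))
  show ?thesis
    using frechet_derivative_at[OF time, symmetric] frechet_derivative_at[OF space, symmetric]
    by (simp add: partial_deriv_def KT_metric_def)
qed

text \<open>The metric is diagonal and depends on the point only through \<open>KT_factor\<close>.
  Derivatives of the zz-coefficient along \<open>v\<close> give the term with \<open>v $ 4\<close>;
  the z-derivatives of all coefficients give the term with \<open>F' (axis 4 1)\<close>. With
  \<open>F'\<close> abstract, the computation never unfolds the potential.\<close>

lemma christoffel_KT_metric_4:
  assumes F': "(KT_factor c M w has_derivative F') (at p)" and nz: "KT_factor c M w p \<noteq> 0"
  shows "(\<Sum>i\<in>UNIV. \<Sum>j\<in>UNIV. christoffel (KT_metric c M w) p 4 i j * v $ i * v $ j) =
    2 * F' v / KT_factor c M w p * v $ 4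
    - F' (axis 4 1) * (((v $ 2)\<^sup>2 + (v $ 3)\<^sup>2 + (v $ 4)\<^sup>2) / KT_factor c M w p
        + (v $ 1)\<^sup>2 / KT_factor c M w p ^ 5)"
proof -
  have "linear F'" using F' by (rule has_derivative_linear)
  \<comment> \<open>Expanding \<open>F' v\<close> in the standard basis turns it into the partial
    derivatives that occur in the Christoffel symbols.\<close>
  have "v = (\<Sum>i\<in>UNIV. v $ i *\<^sub>R axis i 1)"
    by (simp add: vec_eq_iff sum_4 forall_4 axis_def)
  then have "F' v = (\<Sum>i\<in>UNIV. v $ i * F' (axis i 1))"
    by (metis (mono_tags, lifting) \<open>linear F'\<close> linear_scale linear_sum real_scaleR_def sum.cong)
  then show ?thesis
    using nz
    by (simp add: christoffel_def partial_deriv_KT_metric[OF assms] matrix_inv_KT_metric sum_4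
        field_simps eval_nat_numeral)
qed

section \<open>The equation for z along the geodesic\<close>

lemma centre_dist_continuous_on [continuous_intros]:
  assumes "continuous_on I \<gamma>"
  shows "continuous_on I (\<lambda>s. centre_dist a (\<gamma> s))"
  unfolding centre_dist_def by (intro continuous_intros assms)

lemma linear_retraction_proj: "linear retraction_proj"
  by (rule linearI) (simp_all add: retraction_proj_def vec_eq_iff forall_3)

theorem proposition7p2:
  fixes c M w s\<^sub>0 :: real and I :: "real set" and \<gamma> :: "real \<Rightarrow> real ^ 4"
  assumes "M > 0" and "w > 0"
    and "null_geodesic_on (KT_metric c M w) (KT_domain c M w) I \<gamma>"
    and "s\<^sub>0 \<in> I"
    and "retraction_proj (\<gamma> s\<^sub>0) \<in> mid_plane"
    and "velocity I (retraction_proj \<circ> \<gamma>) s\<^sub>0 \<in> mid_plane"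
  shows "(retraction_proj \<circ> \<gamma>) ` I \<subseteq> mid_plane"
proof -
  define v where "v = velocity I \<gamma>"
  define F where "F s = KT_factor c M w (\<gamma> s)" for s
  \<comment> \<open>\<open>A\<close> and \<open>B\<close> are read off from the z-component of the
    geodesic equation, solved for z'', after z has been split off from the z-derivative of the
    conformal factor.\<close>
  define A where "A s = - 2 * KT_differential c M w (\<gamma> s) (v s) / F s" for s
  define B where "B s = KT_restoring M w (\<gamma> s) *
    (((v s $ 2)\<^sup>2 + (v s $ 3)\<^sup>2 + (v s $ 4)\<^sup>2) / F s + (v s $ 1)\<^sup>2 / F s ^ 5)" for s
  have geo: "geodesic_on (KT_metric c M w) (KT_domain c M w) I \<gamma>"
    using assms(3) by (simp add: null_geodesic_on_def)
  then have I: "is_interval I" "interior I \<noteq> {}" and dom: "\<And>s. s \<in> I \<Longrightarrow> \<gamma> s \<in> KT_domain c M w"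
    and diff: "\<gamma> differentiable_on I" "v differentiable_on I"
    by (auto simp: geodesic_on_def v_def)
  note pos = KT_domainD[OF dom]
  have d\<gamma>: "(\<gamma> has_vector_derivative v s) (at s within I)"
    and dv: "(v has_vector_derivative velocity I v s) (at s within I)" if "s \<in> I" for s
    using diff that vector_derivative_works
    by (auto simp: differentiable_on_def velocity_def v_def)
  have dz: "((\<lambda>s. \<gamma> s $ 4) has_real_derivative v s $ 4) (at s within I)" if "s \<in> I" for s
    using bounded_linear.has_vector_derivative[OF bounded_linear_vec_nth d\<gamma>[OF that]]
    by (simp add: has_real_derivative_iff_has_vector_derivative)
  have accel: "velocity I v s $ 4 = A s * v s $ 4 + B s * \<gamma> s $ 4" if "s \<in> I" for s
  proof -
    have "velocity I v s $ 4 + (\<Sum>i\<in>UNIV. \<Sum>j\<in>UNIV.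
        christoffel (KT_metric c M w) (\<gamma> s) 4 i j * v s $ i * v s $ j) = 0"
      using geo that by (simp add: geodesic_on_def v_def)
    then show ?thesis
      unfolding christoffel_KT_metric_4[OF KT_factor_has_derivative[OF dom[OF that]] pos(3)[OF that]]
        KT_differential_axis4[OF dom[OF that]]
      by (simp add: A_def B_def F_def algebra_simps)
  qed
  have dv4: "((\<lambda>s. v s $ 4) has_real_derivative A s * v s $ 4 + B s * \<gamma> s $ 4) (at s within I)"
    if "s \<in> I" for s
    using bounded_linear.has_vector_derivative[OF bounded_linear_vec_nth dv[OF that]] accel[OF that]
    by (metis has_real_derivative_iff_has_vector_derivative)
  have [continuous_intros]: "continuous_on I \<gamma>" "continuous_on I v"
    using diff by (auto intro: differentiable_imp_continuous_on)
  \<comment> \<open>These are all the denominators in \<open>A\<close> and \<open>B\<close>; the sum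
    of the two distances comes from \<open>KT_restoring\<close>.\<close>
  have nz: "\<forall>s\<in>I. centre_dist w (\<gamma> s) \<noteq> 0" "\<forall>s\<in>I. centre_dist (- w) (\<gamma> s) \<noteq> 0"
    "\<forall>s\<in>I. F s \<noteq> 0" "\<forall>s\<in>I. centre_dist w (\<gamma> s) + centre_dist (- w) (\<gamma> s) \<noteq> 0"
    using pos by (force simp: F_def)+
  have [continuous_intros]: "continuous_on I F"
    unfolding F_def KT_factor_alt by (intro continuous_intros nz)
  have "continuous_on I A"
    unfolding A_def KT_differential_def by (intro continuous_intros) (use nz in auto)
  moreover have "continuous_on I B"
    unfolding B_def KT_restoring_def Let_def by (intro continuous_intros) (use nz in auto)
  moreover have "\<gamma> s\<^sub>0 $ 4 = 0"
    using assms(5) by (simp add: mid_plane_def retraction_proj_def)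
  moreover have "v s\<^sub>0 $ 4 = 0"
  proof -
    \<comment> \<open>A nondegenerate interval has \<open>s\<^sub>0\<close> as a limit point, so the
      derivative within \<open>I\<close> is unique. As the projection is linear, the velocity of the
      projected curve is then the projection of \<open>v s\<^sub>0\<close>.\<close>
    have "I \<noteq> {x}" for x using I(2) by auto
    then have "at s\<^sub>0 within I \<noteq> bot"
      using connected_imp_perfect[OF is_interval_connected[OF I(1)] assms(4)]
      by (simp add: trivial_limit_within)
    moreover have "((retraction_proj \<circ> \<gamma>) has_vector_derivative retraction_proj (v s\<^sub>0))
        (at s\<^sub>0 within I)"
      using bounded_linear.has_vector_derivative[OF _ d\<gamma>[OF assms(4)]]
        linear_retraction_proj by (simp add: linear_conv_bounded_linear o_def)
    ultimately have "velocity I (retraction_proj \<circ> \<gamma>) s\<^sub>0 = retraction_proj (v s\<^sub>0)"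
      unfolding velocity_def by (rule vector_derivative_within)
    then show ?thesis
      using assms(6) by (simp add: mid_plane_def retraction_proj_def)
  qed
  ultimately have "\<gamma> t $ 4 = 0" if "t \<in> I" for t
    using linear_ode_zero[OF I(1) assms(4) that dz dv4] by blast
  then show ?thesis
    by (auto simp: mid_plane_def retraction_proj_def)
qed

end
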